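(* Let $G\subset \mathrm{Diff}(\mathbb{C},0)$ be an irreducible group, with basic generators $f_1,\dots,f_{\nu+1}$. If the multiplier of some basic generator is a root of unity of order $p^s$, where $p$ is a prime and $s\in\mathbb{N}=\{0,1,2,\dots\}$, then $G$ is a finite group.
   Context: $\mathrm{Diff}(\mathbb{C},0)$ denotes the group (under composition) of germs at $0$ of complex (holomorphic) diffeomorphisms of $\mathbb{C}$ fixing the origin. The multiplier of $f\in\mathrm{Diff}(\mathbb{C},0)$ is $f'(0)\in\mathbb{C}^*$. A subgroup $G\subset\mathrm{Diff}(\mathbb{C},0)$ is called irreducible if it admits a finite set of generators $f_1,f_2,\dots,f_{\nu+1}\in G$ (repetitions $f_i=f_j$ are allowed) such that: (a) $f_1\circ f_2\circ\cdots\circ f_{\nu+1}=\mathrm{id}$; (b) $f_i$ and $f_j$ are conjugate in $G$ for all $i,j$ (that is, for all $i,j$ there is $g\in G$ with $f_i\circ g=g\circ f_j$). The maps $f_1,\dots,f_{\nu+1}$ are called basic generators of $G$. The case $s=0$ (multiplier equal to $1$) is included. *)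

theory Defs
  imports "HOL-Analysis.Analysis" "HOL-Algebra.Generated_Groups"
    "HOL-Computational_Algebra.Primes"
begin

definition local_diffeo0 :: "(complex \<Rightarrow> complex) \<Rightarrow> bool" where
  "local_diffeo0 f \<longleftrightarrow> f 0 = 0 \<and>
     (\<exists>U V g. open U \<and> open V \<and> 0 \<in> U \<and> f holomorphic_on U \<and> g holomorphic_on V \<and>
        homeomorphism U V f g)"

lemma local_diffeo0_id: "local_diffeo0 (\<lambda>z. z)"
  unfolding local_diffeo0_def
  by (intro conjI exI[of _ UNIV] exI[of _ "\<lambda>z. z"]) (auto simp: homeomorphism_def)

lemma local_diffeo0_comp:
  assumes "local_diffeo0 f" "local_diffeo0 h"
  shows "local_diffeo0 (f \<circ> h)"
proof -
  obtain U V g where f: "f 0 = 0" "open U" "open V" "0 \<in> U" "f holomorphic_on U"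
      "g holomorphic_on V" "homeomorphism U V f g"
    using assms(1) unfolding local_diffeo0_def by blast
  obtain U' V' g' where h: "h 0 = 0" "open U'" "open V'" "0 \<in> U'" "h holomorphic_on U'"
      "g' holomorphic_on V'" "homeomorphism U' V' h g'"
    using assms(2) unfolding local_diffeo0_def by blast
  define W where "W = U' \<inter> h -` U"
  define X where "X = V \<inter> g -` V'"
  have oW: "open W"
    unfolding W_def by (rule continuous_open_preimage[OF holomorphic_on_imp_continuous_on[OF h(5)] h(2) f(2)])
  have oX: "open X"
    unfolding X_def by (rule continuous_open_preimage[OF holomorphic_on_imp_continuous_on[OF f(6)] f(3) h(3)])
  have e: "\<And>x. x \<in> U \<Longrightarrow> f x \<in> V \<and> g (f x) = x" "\<And>y. y \<in> V \<Longrightarrow> g y \<in> U \<and> f (g y) = y"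
    using f(7) unfolding homeomorphism_def by blast+
  have e': "\<And>x. x \<in> U' \<Longrightarrow> h x \<in> V' \<and> g' (h x) = x" "\<And>y. y \<in> V' \<Longrightarrow> g' y \<in> U' \<and> h (g' y) = y"
    using h(7) unfolding homeomorphism_def by blast+
  have hol: "(f \<circ> h) holomorphic_on W" "(g' \<circ> g) holomorphic_on X"
    by (rule holomorphic_on_compose_gen[OF holomorphic_on_subset[OF h(5)] f(5)]; auto simp: W_def)
       (rule holomorphic_on_compose_gen[OF holomorphic_on_subset[OF f(6)] h(6)]; auto simp: X_def)
  have "homeomorphism W X (f \<circ> h) (g' \<circ> g)"
    by (rule homeomorphismI)
       (use hol[THEN holomorphic_on_imp_continuous_on] e e' in \<open>auto simp: W_def X_def\<close>)
  moreover have "0 \<in> W" using f h by (auto simp: W_def)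
  moreover have "(f \<circ> h) 0 = 0" using f(1) h(1) by simp
  ultimately show ?thesis
    unfolding local_diffeo0_def using oW oX hol by blast
qed

definition germ_eq :: "(complex \<Rightarrow> complex) \<Rightarrow> (complex \<Rightarrow> complex) \<Rightarrow> bool" where
  "germ_eq f g \<longleftrightarrow> local_diffeo0 f \<and> local_diffeo0 g \<and> eventually (\<lambda>z. f z = g z) (nhds 0)"

quotient_type diff_germ = "complex \<Rightarrow> complex" / partial: germ_eq
proof (rule part_equivpI)
  show "\<exists>f. germ_eq f f"
    using local_diffeo0_id unfolding germ_eq_def by auto
  show "symp germ_eq"
    unfolding germ_eq_def by (auto intro!: sympI simp: eq_commute)
  show "transp germ_eq"
  proof (rule transpI)
    fix f g h assume a: "germ_eq f g" "germ_eq g h"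
    then have "eventually (\<lambda>z. f z = g z) (nhds 0)" "eventually (\<lambda>z. g z = h z) (nhds 0)"
      unfolding germ_eq_def by blast+
    then have "eventually (\<lambda>z. f z = h z) (nhds 0)"
      by eventually_elim simp
    with a show "germ_eq f h" unfolding germ_eq_def by blast
  qed
qed

lemma local_diffeo0_filterlim:
  assumes "local_diffeo0 f"
  shows "filterlim f (nhds 0) (nhds 0)"
proof -
  obtain U where f: "f 0 = 0" "open U" "0 \<in> U" "f holomorphic_on U"
    using assms unfolding local_diffeo0_def by blast
  then have "isCont f 0"
    using continuous_on_eq_continuous_at holomorphic_on_imp_continuous_on by blast
  then show ?thesis
    using f(1) tendsto_at_iff_tendsto_nhds[of f 0] by (simp add: isCont_def)
qed

lift_definition germ_id :: diff_germ is "\<lambda>z. z"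
  by (simp add: germ_eq_def local_diffeo0_id)

lift_definition germ_comp :: "diff_germ \<Rightarrow> diff_germ \<Rightarrow> diff_germ" is "\<lambda>f h. f \<circ> h"
proof -
  fix f f' h h' assume a: "germ_eq f f'" "germ_eq h h'"
  then have "eventually (\<lambda>z. f (h z) = f' (h z)) (nhds 0)"
    unfolding germ_eq_def
    using eventually_compose_filterlim[of "\<lambda>z. f z = f' z" "nhds 0" h "nhds 0"]
      local_diffeo0_filterlim[of h] by simp
  then have "eventually (\<lambda>z. f (h z) = f' (h' z)) (nhds 0)"
    using a(2) unfolding germ_eq_def by (auto elim: eventually_elim2)
  then show "germ_eq (f \<circ> h) (f' \<circ> h')"
    using a by (simp add: germ_eq_def local_diffeo0_comp)
qed

lift_definition multiplier :: "diff_germ \<Rightarrow> complex" is "\<lambda>f. deriv f 0"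
  by (simp add: germ_eq_def deriv_cong_ev)

definition Diff0 :: "diff_germ monoid" where
  "Diff0 = \<lparr>carrier = UNIV, mult = germ_comp, one = germ_id\<rparr>"

lemma germ_inverse_exists: "\<exists>G. germ_comp G F = germ_id"
proof (transfer)
  fix f assume "germ_eq f f"
  then obtain U V g where f: "f 0 = 0" "open U" "open V" "0 \<in> U" "f holomorphic_on U"
      "g holomorphic_on V" "homeomorphism U V f g"
    unfolding germ_eq_def local_diffeo0_def by blast
  have e: "\<And>x. x \<in> U \<Longrightarrow> f x \<in> V \<and> g (f x) = x"
    using f(7) unfolding homeomorphism_def by blast
  have g: "local_diffeo0 g"
    unfolding local_diffeo0_def
  proof (intro conjI exI)
    show "g 0 = 0" "0 \<in> V" using e[of 0] f(1,4) by auto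
    show "homeomorphism V U g f" using f(7) by (rule homeomorphism_symD)
  qed (use f in auto)
  have "eventually (\<lambda>z. (g \<circ> f) z = z) (nhds 0)"
    using e f(2,4) by (auto simp: eventually_nhds)
  with g \<open>germ_eq f f\<close> show "\<exists>g\<in>{x. germ_eq x x}. germ_eq (g \<circ> f) (\<lambda>z. z)"
    by (auto simp: germ_eq_def local_diffeo0_id local_diffeo0_comp)
qed

lemma group_Diff0: "group Diff0"
proof (rule groupI)
  fix F G H assume "F \<in> carrier Diff0" "G \<in> carrier Diff0" "H \<in> carrier Diff0"
  show "F \<otimes>\<^bsub>Diff0\<^esub> G \<otimes>\<^bsub>Diff0\<^esub> H = F \<otimes>\<^bsub>Diff0\<^esub> (G \<otimes>\<^bsub>Diff0\<^esub> H)"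
    unfolding Diff0_def monoid.simps
    by transfer (simp add: comp_assoc germ_eq_def local_diffeo0_comp)
next
  fix F assume "F \<in> carrier Diff0"
  show "\<one>\<^bsub>Diff0\<^esub> \<otimes>\<^bsub>Diff0\<^esub> F = F"
    unfolding Diff0_def monoid.simps
    by transfer (simp add: comp_def)
  show "\<exists>G\<in>carrier Diff0. G \<otimes>\<^bsub>Diff0\<^esub> F = \<one>\<^bsub>Diff0\<^esub>"
    using germ_inverse_exists[of F] by (simp add: Diff0_def)
qed (simp_all add: Diff0_def)

text \<open>
  The list is the sequence of basic generators, of length \<open>\<nu> + 1 \<ge> 1\<close>; being a list rather than a
  set, it may repeat an element, and each repetition is a factor of the product.
\<close>

definition basic_generators :: "diff_germ set \<Rightarrow> diff_germ list \<Rightarrow> bool" where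
  "basic_generators G fs \<longleftrightarrow>
     fs \<noteq> [] \<and> set fs \<subseteq> G \<and> generate Diff0 (set fs) = G \<and>
     foldr (mult Diff0) fs \<one>\<^bsub>Diff0\<^esub> = \<one>\<^bsub>Diff0\<^esub> \<and>
     (\<forall>f\<in>set fs. \<forall>f'\<in>set fs. \<exists>g\<in>G. f \<otimes>\<^bsub>Diff0\<^esub> g = g \<otimes>\<^bsub>Diff0\<^esub> f')"

definition irreducible_germ_group :: "diff_germ set \<Rightarrow> bool" where
  "irreducible_germ_group G \<longleftrightarrow> subgroup G Diff0 \<and> (\<exists>fs. basic_generators G fs)"

definition root_of_unity_of_order :: "nat \<Rightarrow> complex \<Rightarrow> bool" where
  "root_of_unity_of_order n z \<longleftrightarrow> 0 < n \<and> z ^ n = 1 \<and> (\<forall>m. 0 < m \<and> m < n \<longrightarrow> z ^ m \<noteq> 1)"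

end

theory Submission
  imports Defs "HOL-Complex_Analysis.Conformal_Mappings"
begin

text \<open>
  All \<open>f\<^sub>i\<close> share a multiplier \<open>\<lambda>\<close> of order \<open>q = p\<^sup>s\<close>, so it suffices that the subgroup \<open>K\<close> of elements
  with multiplier \<open>1\<close> is trivial. Otherwise take the least \<open>k\<close> for which some element of \<open>K\<close> is
  \<open>z + a z\<^sup>k\<^sup>+\<^sup>1 + \<dots>\<close> with \<open>a \<noteq> 0\<close>. Then \<open>g \<mapsto> a\<close> is a nonzero homomorphism \<open>\<alpha>\<close> from \<open>K\<close> to the additive
  group of complex numbers, and conjugation by \<open>f = f\<^sub>1\<close> multiplies \<open>\<alpha>\<close> by \<open>\<mu> = \<lambda>\<^sup>-\<^sup>k\<close>.

  Conjugacy of the generators puts each slope \<open>\<alpha> (f\<^sub>i f\<inverse>)\<close> into \<open>(1 - \<mu>) \<alpha>(K)\<close>. Moreover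
  \<open>\<alpha> (f\<^sup>q) = 0\<close>: since \<open>f\<close> commutes with \<open>f\<^sup>q\<close> this is clear if \<open>\<mu> \<noteq> 1\<close>; if \<open>\<mu> = 1\<close> all slopes vanish
  and the relation \<open>f\<^sub>1 \<cdots> f\<^sub>n = 1\<close> forces \<open>\<alpha> (f\<^sup>n) = 0\<close> with \<open>q\<close> dividing \<open>n\<close>. Hence \<open>N = \<alpha>(K)\<close> is
  the \<open>\<int>[\<mu>]\<close>-module generated by the slopes, and \<open>N = (1 - \<mu>) N\<close>. As \<open>(1 - \<mu>)\<^sup>q\<close> is divisible by \<open>p\<close>
  in \<open>\<int>[\<mu>]\<close>, also \<open>N = p N\<close>, which is impossible for a nonzero finitely generated torsion-free group.
\<close>

section \<open>Modules over a cyclotomic ring\<close>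

text \<open>In the absorption identity i * C(q,i) = q * C(q-1,i-1) with q = \<open>p ^ s\<close>, a
  binomial coefficient prime to \<open>p\<close> would force q to divide \<open>i\<close>, which is
  positive and smaller than q.\<close>

lemma prime_dvd_prime_power_choose:
  fixes p :: nat
  assumes "prime p" "0 < i" "i < p ^ s"
  shows "p dvd (p ^ s choose i)"
proof (rule ccontr)
  assume "\<not> p dvd (p ^ s choose i)"
  then have cop: "coprime (p ^ s) (p ^ s choose i)"
    using assms(1) by (simp add: prime_imp_coprime)
  have "i * (p ^ s choose i) = p ^ s * (p ^ s - 1 choose (i - 1))"
    using binomial_absorption[of "i - 1" "p ^ s"] assms by simp
  then have "p ^ s dvd i"
    using cop by (metis coprime_dvd_mult_left_iff dvd_triv_left)
  then show False using assms by (auto dest: dvd_imp_le)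
qed

text \<open>Gaussian elimination over the integers localised at \<open>p\<close>, with the denominators \<open>d\<close> cleared.\<close>

lemma p_divisible_span_trivial:
  fixes p :: int and S :: "complex set"
  assumes "finite S" "prime p"
    and "\<And>v. v \<in> S \<Longrightarrow> \<exists>d r. \<not> p dvd d \<and> of_int d * v = of_int p * (\<Sum>w\<in>S. of_int (r w) * w)"
  shows "S \<subseteq> {0}"
  using assms(1,3)
proof (induction S rule: finite_induct)
  case (insert x S)
  obtain d r where dr: "\<not> p dvd d"
      "of_int d * x = of_int p * (\<Sum>w\<in>insert x S. of_int (r w) * w)"
    using insert.prems[of x] by blast
  \<comment> \<open>Moving the \<open>x\<close>-term to the left leaves the coefficient
    \<open>e\<close>, which is congruent to \<open>d\<close> modulo \<open>p\<close>; so
    \<open>x\<close> can be eliminated.\<close>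
  define e where "e = d - p * r x"
  have e: "\<not> p dvd e" using dr(1) unfolding e_def by (metis dvd_diff_right_iff dvd_triv_left dvd_diff_left_iff)
  have ex: "of_int e * x = of_int p * (\<Sum>w\<in>S. of_int (r w) * w)"
    using dr(2) insert.hyps by (simp add: e_def algebra_simps)
  have "S \<subseteq> {0}"
  proof (rule insert.IH)
    fix v assume v: "v \<in> S"
    obtain d' r' where dr': "\<not> p dvd d'"
        "of_int d' * v = of_int p * (\<Sum>w\<in>insert x S. of_int (r' w) * w)"
      using insert.prems[of v] v by blast
    \<comment> \<open>Multiplying the relation for \<open>v\<close> by \<open>e\<close> makes room
      to replace \<open>e\<close> times \<open>x\<close> by \<open>ex\<close>; the factor
      \<open>p\<close> in front survives.\<close>
    have "of_int (e * d') * v = of_int e * (of_int d' * v)" by simp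
    also have "\<dots> = of_int p * (of_int (r' x) * (of_int e * x) + of_int e * (\<Sum>w\<in>S. of_int (r' w) * w))"
      using dr'(2) insert.hyps by (simp add: algebra_simps)
    also have "\<dots> = of_int p * (\<Sum>w\<in>S. of_int (r' x * p * r w + e * r' w) * w)"
      unfolding ex by (simp add: sum.distrib sum_distrib_left algebra_simps)
    finally have "of_int (e * d') * v = of_int p * (\<Sum>w\<in>S. of_int (r' x * p * r w + e * r' w) * w)" .
    moreover have "\<not> p dvd e * d'" using e dr'(1) assms(2) by (simp add: prime_dvd_mult_iff)
    ultimately show "\<exists>d r. \<not> p dvd d \<and> of_int d * v = of_int p * (\<Sum>w\<in>S. of_int (r w) * w)"
      by (intro exI[of _ "e * d'"] exI[of _ "\<lambda>w. r' x * p * r w + e * r' w"] conjI)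
  qed
  then have "(\<Sum>w\<in>S. of_int (r w) * w) = 0" by (intro sum.neutral) auto
  then have "of_int e * x = 0" using ex by simp
  moreover have "e \<noteq> 0" using e by auto
  ultimately show ?case using \<open>S \<subseteq> {0}\<close> by simp
qed simp

text \<open>This is the \<int>[\<mu>]-submodule of the complex numbers generated by
  \<open>A\<close>; closure under differences supplies sums and negatives.\<close>

inductive_set cyc_span :: "complex \<Rightarrow> complex set \<Rightarrow> complex set" for \<mu> A where
  zero: "0 \<in> cyc_span \<mu> A"
| base: "a \<in> A \<Longrightarrow> a \<in> cyc_span \<mu> A"
| diff: "x \<in> cyc_span \<mu> A \<Longrightarrow> y \<in> cyc_span \<mu> A \<Longrightarrow> x - y \<in> cyc_span \<mu> A"
| scale: "x \<in> cyc_span \<mu> A \<Longrightarrow> \<mu> * x \<in> cyc_span \<mu> A"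

lemma cyc_span_uminus: "x \<in> cyc_span \<mu> A \<Longrightarrow> - x \<in> cyc_span \<mu> A"
  using cyc_span.diff[OF cyc_span.zero] by fastforce

lemma cyc_span_add: "x \<in> cyc_span \<mu> A \<Longrightarrow> y \<in> cyc_span \<mu> A \<Longrightarrow> x + y \<in> cyc_span \<mu> A"
  using cyc_span.diff[of x \<mu> A "- y"] cyc_span_uminus by fastforce

lemma cyc_span_power: "x \<in> cyc_span \<mu> A \<Longrightarrow> \<mu> ^ n * x \<in> cyc_span \<mu> A"
  by (induction n) (auto simp: mult.assoc intro: cyc_span.scale)

lemma cyc_span_of_nat: "x \<in> cyc_span \<mu> A \<Longrightarrow> of_nat n * x \<in> cyc_span \<mu> A"
  by (induction n) (auto simp: algebra_simps intro: cyc_span.zero cyc_span_add)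

lemma cyc_span_sum: "(\<And>i. i \<in> I \<Longrightarrow> f i \<in> cyc_span \<mu> A) \<Longrightarrow> sum f I \<in> cyc_span \<mu> A"
  by (induction I rule: infinite_finite_induct) (auto intro: cyc_span.zero cyc_span_add)

text \<open>Multiplication by \<mu> permutes the finite set \<open>S\<close>, because exponents may
  be reduced modulo \<open>q\<close>; hence the integer span of \<open>S\<close> is already closed
  under scaling by \<mu>. Coefficients are attached to values, so coincidences among the products do
  no harm.\<close>

lemma cyc_span_subset_int_span:
  assumes "finite A" "\<mu> ^ q = 1" "0 < q" "x \<in> cyc_span \<mu> A"
  defines "S \<equiv> (\<lambda>(j, a). \<mu> ^ j * a) ` ({..<q} \<times> A)"
  shows "\<exists>r. x = (\<Sum>w\<in>S. of_int (r w) * w)"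
  using assms(4)
proof induction
  case zero
  show ?case by (rule exI[of _ "\<lambda>_. 0"]) simp
next
  case (base a)
  then have "a \<in> S" using assms(3) by (force simp: S_def)
  moreover have "finite S" using assms(1) by (simp add: S_def)
  moreover have "(\<Sum>w\<in>S. of_int (if w = a then 1 else 0) * w) = (\<Sum>w\<in>S. if w = a then w else 0)"
    by (intro sum.cong) auto
  ultimately have "a = (\<Sum>w\<in>S. of_int (if w = a then 1 else 0) * w)" by simp
  then show ?case by (intro exI[of _ "\<lambda>w. if w = a then 1 else 0"])
next
  case (diff x y)
  then obtain r r' where "x = (\<Sum>w\<in>S. of_int (r w) * w)" "y = (\<Sum>w\<in>S. of_int (r' w) * w)"
    by blast
  then have "x - y = (\<Sum>w\<in>S. of_int (r w - r' w) * w)"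
    by (simp add: sum_subtractf algebra_simps)
  then show ?case by (intro exI[of _ "\<lambda>w. r w - r' w"])
next
  case (scale x)
  then obtain r where r: "x = (\<Sum>w\<in>S. of_int (r w) * w)" by blast
  have \<mu>0: "\<mu> \<noteq> 0" using assms(2,3) by (auto simp: power_0_left)
  have fS: "finite S" using assms(1) by (simp add: S_def)
  have sub: "(\<lambda>w. \<mu> * w) ` S \<subseteq> S"
  proof clarify
    fix w assume "w \<in> S"
    then obtain j a where w: "j < q" "a \<in> A" "w = \<mu> ^ j * a" by (auto simp: S_def)
    have "\<mu> * w = \<mu> ^ (Suc j mod q) * a"
    proof (cases "Suc j = q")
      case True
      then have "\<mu> * w = a" using assms(2) w(3) by (metis mult.assoc mult_1 power_Suc)
      then show ?thesis using True by simp
    next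
      case False
      then show ?thesis using w by (simp add: mult.assoc)
    qed
    then show "\<mu> * w \<in> S"
      using w(2) assms(3) unfolding S_def by (intro image_eqI[of _ _ "(Suc j mod q, a)"]) auto
  qed
  have inj: "inj_on (\<lambda>w. \<mu> * w) S" using \<mu>0 by (auto simp: inj_on_def)
  then have bij: "bij_betw (\<lambda>w. \<mu> * w) S S"
    using endo_inj_surj[OF fS sub] by (simp add: bij_betw_def)
  \<comment> \<open>The coefficient of \<open>w\<close> is written as a function of
    \<open>\<mu> * w\<close>, so that the sum can be reindexed along the permutation.\<close>
  have "\<mu> * x = (\<Sum>w\<in>S. of_int (r ((\<mu> * w) / \<mu>)) * (\<mu> * w))"
    using \<mu>0 by (simp add: r sum_distrib_left mult_ac)
  also have "\<dots> = (\<Sum>w\<in>S. of_int (r (w / \<mu>)) * w)"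
    by (rule sum.reindex_bij_betw[OF bij, of "\<lambda>w. of_int (r (w / \<mu>)) * w"])
  finally show ?case by (rule exI[of _ "\<lambda>w. r (w / \<mu>)"])
qed

text \<open>Modulo \<open>p\<close> one has \<open>(1 - \<mu>)\<^sup>q = 1 - \<mu>\<^sup>q = 0\<close>.\<close>

lemma one_minus_power_cyc_span:
  fixes p :: nat
  assumes "prime p" "\<mu> ^ (p ^ s) = 1" "x \<in> cyc_span \<mu> A"
  shows "\<exists>y\<in>cyc_span \<mu> A. (1 - \<mu>) ^ (p ^ s) * x = of_nat p * y"
proof -
  let ?q = "p ^ s"
  have q: "0 < ?q" using assms(1) prime_gt_0_nat by simp
  have pw: "(- \<mu>) ^ i * x \<in> cyc_span \<mu> A" for i
    using cyc_span_power[OF assms(3), of i] cyc_span_uminus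
    by (cases "even i") (auto simp: power_minus_odd)
  \<comment> \<open>The two extreme binomial terms add up to 0 when \<open>?q\<close> is odd and to
    2 when it is even, and in the even case \<open>p = 2\<close>.\<close>
  have ends: "\<exists>y\<in>cyc_span \<mu> A. (1 + (- \<mu>) ^ ?q) * x = of_nat p * y"
  proof (cases "odd ?q")
    case True
    then show ?thesis using assms(2) by (auto intro: bexI[OF _ cyc_span.zero] simp: power_minus_odd)
  next
    case False
    then have "p = 2" using assms(1) primes_dvd_imp_eq two_is_prime_nat prime_dvd_power by blast
    then show ?thesis using False assms(2,3) by (intro bexI[of _ x]) (simp_all add: power_minus_even)
  qed
  then obtain y where y: "y \<in> cyc_span \<mu> A" "(1 + (- \<mu>) ^ ?q) * x = of_nat p * y" by blast
  have "(1 - \<mu>) ^ ?q * x = (\<Sum>i\<le>?q. of_nat (?q choose i) * (- \<mu>) ^ i) * x"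
    using binomial_ring[of "- \<mu>" 1 ?q] by (simp add: add.commute)
  also have "{..?q} = insert 0 (insert ?q {0<..<?q})" using q by auto
  also have "(\<Sum>i\<in>\<dots>. of_nat (?q choose i) * (- \<mu>) ^ i) * x =
      (1 + (- \<mu>) ^ ?q) * x + (\<Sum>i\<in>{0<..<?q}. of_nat (?q choose i) * ((- \<mu>) ^ i * x))"
    using q by (simp add: sum_distrib_left sum_distrib_right algebra_simps)
  also have "(\<Sum>i\<in>{0<..<?q}. of_nat (?q choose i) * ((- \<mu>) ^ i * x)) =
      of_nat p * (\<Sum>i\<in>{0<..<?q}. of_nat ((?q choose i) div p) * ((- \<mu>) ^ i * x))"
    unfolding sum_distrib_left
  proof (rule sum.cong[OF refl])
    fix i assume "i \<in> {0<..<?q}"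
    then have "?q choose i = p * ((?q choose i) div p)"
      using prime_dvd_prime_power_choose[OF assms(1)] by simp
    then have "(of_nat (?q choose i) :: complex) = of_nat p * of_nat ((?q choose i) div p)"
      by (metis of_nat_mult)
    then show "of_nat (?q choose i) * ((- \<mu>) ^ i * x) =
        of_nat p * (of_nat ((?q choose i) div p) * ((- \<mu>) ^ i * x))"
      by (simp only: mult.assoc)
  qed
  finally have "(1 - \<mu>) ^ ?q * x =
      of_nat p * (y + (\<Sum>i\<in>{0<..<?q}. of_nat ((?q choose i) div p) * ((- \<mu>) ^ i * x)))"
    by (simp only: y(2) distrib_left)
  moreover have "y + (\<Sum>i\<in>{0<..<?q}. of_nat ((?q choose i) div p) * ((- \<mu>) ^ i * x)) \<in> cyc_span \<mu> A"
    by (intro cyc_span_add cyc_span_sum cyc_span_of_nat pw y(1))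
  ultimately show ?thesis by blast
qed

text \<open>Divisibility by \<open>1 - \<mu>\<close> extends from generators to the whole module and
  can be iterated \<open>p ^ s\<close> times, which yields divisibility by \<open>p\<close>. The
  module has a finite spanning set over the integers, so elimination reduces that set to
  zero.\<close>

lemma cyc_span_nakayama:
  fixes p :: nat
  assumes "finite A" "prime p" "\<mu> ^ (p ^ s) = 1"
    and "\<And>a. a \<in> A \<Longrightarrow> \<exists>x\<in>cyc_span \<mu> A. a = (1 - \<mu>) * x"
  shows "cyc_span \<mu> A \<subseteq> {0}"
proof -
  let ?q = "p ^ s"
  let ?N = "cyc_span \<mu> A"
  define S where "S = (\<lambda>(j, a). \<mu> ^ j * a) ` ({..<?q} \<times> A)"
  have q: "0 < ?q" using assms(2) prime_gt_0_nat by simp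
  have one: "\<exists>y\<in>?N. x = (1 - \<mu>) * y" if "x \<in> ?N" for x
    using that
  proof induction
    case zero
    show ?case by (rule bexI[OF _ cyc_span.zero]) simp
  next
    case (base a)
    then show ?case using assms(4) by blast
  next
    case (diff x y)
    then show ?case by (metis cyc_span.diff right_diff_distrib)
  next
    case (scale x)
    then show ?case by (metis cyc_span.scale mult.left_commute)
  qed
  have pow: "\<exists>y\<in>?N. x = (1 - \<mu>) ^ n * y" if "x \<in> ?N" for x n
  proof (induction n)
    case 0
    then show ?case using that by simp
  next
    case (Suc n)
    then show ?case using one by (metis mult.assoc power_Suc2)
  qed
  have dvd: "\<exists>y\<in>?N. x = of_nat p * y" if "x \<in> ?N" for x
    using pow[OF that, of ?q] one_minus_power_cyc_span[OF assms(2,3)] by blast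
  have fS: "finite S" using assms(1) by (simp add: S_def)
  have SN: "S \<subseteq> ?N" by (auto simp: S_def intro: cyc_span_power cyc_span.base)
  have span: "\<exists>r. x = (\<Sum>w\<in>S. of_int (r w) * w)" if "x \<in> ?N" for x
    using cyc_span_subset_int_span[OF assms(1,3) q that] unfolding S_def .
  have "S \<subseteq> {0}"
  proof (rule p_divisible_span_trivial[OF fS])
    show "prime (int p)" using assms(2) by simp
    fix v assume "v \<in> S"
    then obtain y r where "v = of_nat p * y" "y = (\<Sum>w\<in>S. of_int (r w) * w)"
      using SN dvd span by blast
    then show "\<exists>d r. \<not> int p dvd d \<and> of_int d * v = of_int (int p) * (\<Sum>w\<in>S. of_int (r w) * w)"
      using assms(2) by (intro exI[of _ 1] exI[of _ r]) (simp add: prime_nat_iff)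
  qed
  show ?thesis
  proof
    fix x assume "x \<in> ?N"
    then obtain r where r: "x = (\<Sum>w\<in>S. of_int (r w) * w)" using span by blast
    have "(\<Sum>w\<in>S. of_int (r w) * w) = 0" using \<open>S \<subseteq> {0}\<close> by (intro sum.neutral) auto
    then show "x \<in> {0}" using r by simp
  qed
qed

section \<open>Groups generated by conjugate elements\<close>

context group
begin

lemma inv_mult_cancel: "x \<in> carrier G \<Longrightarrow> y \<in> carrier G \<Longrightarrow> inv x \<otimes> (x \<otimes> y) = y"
  by (simp add: m_assoc[symmetric])

lemma mult_inv_cancel: "x \<in> carrier G \<Longrightarrow> y \<in> carrier G \<Longrightarrow> x \<otimes> (inv x \<otimes> y) = y"
  by (simp add: m_assoc[symmetric])

end

text \<open>For germs, \<open>m\<close> is the multiplier and \<open>\<alpha>\<close> the coefficient of \<open>z\<^sup>k\<^sup>+\<^sup>1\<close>, which is a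
  homomorphism only on elements of multiplier \<open>1\<close>.\<close>

locale conjugate_generators = group G for G (structure) +
  fixes fs :: "'a list" and f :: 'a and m \<alpha> :: "'a \<Rightarrow> complex" and \<mu> :: complex and p s :: nat
  assumes fs_closed: "set fs \<subseteq> carrier G"
    and f_in_fs: "f \<in> set fs"
    and prod_fs: "foldr (\<otimes>) fs \<one> = \<one>"
    and conj_fs: "\<And>h h'. h \<in> set fs \<Longrightarrow> h' \<in> set fs \<Longrightarrow> \<exists>g\<in>generate G (set fs). h \<otimes> g = g \<otimes> h'"
    and m_mult: "\<And>x y. x \<in> carrier G \<Longrightarrow> y \<in> carrier G \<Longrightarrow> m (x \<otimes> y) = m x * m y"
    and m_nonzero: "\<And>x. x \<in> carrier G \<Longrightarrow> m x \<noteq> 0"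
    and prime_p: "prime p"
    and m_order: "root_of_unity_of_order (p ^ s) (m f)"
    and \<alpha>_mult: "\<And>x y. \<lbrakk>x \<in> generate G (set fs); y \<in> generate G (set fs); m x = 1; m y = 1\<rbrakk>
        \<Longrightarrow> \<alpha> (x \<otimes> y) = \<alpha> x + \<alpha> y"
    and \<alpha>_conj: "\<And>x. \<lbrakk>x \<in> generate G (set fs); m x = 1\<rbrakk> \<Longrightarrow> \<alpha> (f \<otimes> x \<otimes> inv f) = \<mu> * \<alpha> x"
    and \<mu>_power: "\<mu> ^ (p ^ s) = 1"
begin

section \<open>The kernel of the multiplier and the slopes of the generators\<close>

definition H where "H = generate G (set fs)"
definition K where "K = {x \<in> H. m x = 1}"

text \<open>A slope measures how far a generator is from \<open>f\<close>. Conjugate generators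
  share one multiplier, so \<open>h \<otimes> inv f\<close> lies in \<open>K\<close>, where \<alpha>
  is additive.\<close>

definition slopes where "slopes = (\<lambda>h. \<alpha> (h \<otimes> inv f)) ` set fs"

lemma subgroup_H: "subgroup H G"
  unfolding H_def using fs_closed by (rule generate_is_subgroup)

lemma H_closed: "x \<in> H \<Longrightarrow> x \<in> carrier G"
  by (rule subgroup.mem_carrier[OF subgroup_H])

lemma m_one [simp]: "m \<one> = 1"
  using m_mult[of \<one> \<one>] m_nonzero[of \<one>] by simp

lemma m_inv: "x \<in> carrier G \<Longrightarrow> m (inv x) = inverse (m x)"
  using m_mult[of x "inv x"] m_nonzero[of x] by (simp add: field_simps)

lemma m_pow: "x \<in> carrier G \<Longrightarrow> m (x [^] (n::nat)) = m x ^ n"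
  by (induction n) (simp_all add: m_mult mult.commute)

lemma in_H: "h \<in> set fs \<Longrightarrow> h \<in> H"
  by (simp add: H_def generate.incl)

lemmas H_rules = subgroup.m_closed[OF subgroup_H] subgroup.m_inv_closed[OF subgroup_H]
  subgroup.one_closed[OF subgroup_H]

lemma f_H [simp]: "f \<in> H" and f_carrier [simp]: "f \<in> carrier G"
  using f_in_fs in_H H_closed by blast+

lemma pow_H [simp]: "f [^] (n::nat) \<in> H"
  by (induction n) (auto intro: H_rules)

lemma subgroup_K: "subgroup K G"
  by (rule subgroupI) (auto simp: K_def H_closed m_inv m_mult intro: H_rules)

lemmas K_rules = subgroup.m_closed[OF subgroup_K] subgroup.m_inv_closed[OF subgroup_K]
  subgroup.one_closed[OF subgroup_K]

lemma K_closed: "x \<in> K \<Longrightarrow> x \<in> carrier G" and K_H: "x \<in> K \<Longrightarrow> x \<in> H"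
  by (auto simp: K_def H_closed)

lemma \<alpha>_K_mult: "x \<in> K \<Longrightarrow> y \<in> K \<Longrightarrow> \<alpha> (x \<otimes> y) = \<alpha> x + \<alpha> y"
  using \<alpha>_mult by (simp add: K_def H_def)

lemma \<alpha>_one: "\<alpha> \<one> = 0"
  using \<alpha>_K_mult[of \<one> \<one>] K_rules(3) by simp

lemma \<alpha>_inv: "x \<in> K \<Longrightarrow> \<alpha> (inv x) = - \<alpha> x"
  using \<alpha>_K_mult[of x "inv x"] K_rules(2) \<alpha>_one by (simp add: K_closed add_eq_0_iff)

lemma \<alpha>_K_pow: "x \<in> K \<Longrightarrow> x [^] (n::nat) \<in> K \<and> \<alpha> (x [^] n) = of_nat n * \<alpha> x"
  by (induction n) (auto simp: \<alpha>_one \<alpha>_K_mult algebra_simps intro: K_rules)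

lemma K_conj: "x \<in> K \<Longrightarrow> g \<in> H \<Longrightarrow> g \<otimes> x \<otimes> inv g \<in> K"
  by (auto simp: K_def H_closed m_mult m_inv m_nonzero intro: H_rules)

lemma \<alpha>_f_conj: "x \<in> K \<Longrightarrow> \<alpha> (f \<otimes> x \<otimes> inv f) = \<mu> * \<alpha> x"
  using \<alpha>_conj by (simp add: K_def H_def)

lemma \<alpha>_pow_conj: "x \<in> K \<Longrightarrow> \<alpha> (f [^] (n::nat) \<otimes> x \<otimes> inv (f [^] n)) = \<mu> ^ n * \<alpha> x"
proof (induction n arbitrary: x)
  case (Suc n)
  have "f [^] Suc n \<otimes> x \<otimes> inv (f [^] Suc n) = f [^] n \<otimes> (f \<otimes> x \<otimes> inv f) \<otimes> inv (f [^] n)"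
    using K_closed[OF Suc.prems] by (simp add: m_assoc inv_mult_group inv_mult_cancel mult_inv_cancel)
  then show ?case using Suc K_conj[OF Suc.prems f_H] \<alpha>_f_conj by simp
qed (simp add: K_closed)

lemma m_f_power: "m f ^ (p ^ s) = 1" and q_pos: "0 < p ^ s"
  using m_order by (simp_all add: root_of_unity_of_order_def)

lemma fq_K: "f [^] (p ^ s) \<in> K"
  by (simp add: K_def m_pow m_f_power)

text \<open>The multiplier of \<open>f\<close> has exact order \<open>p ^ s\<close>, so the
  remainder of \<open>j\<close> modulo \<open>p ^ s\<close> must vanish.\<close>

lemma pow_K:
  assumes "f [^] (j::nat) \<in> K"
  shows "\<exists>l. f [^] j = (f [^] (p ^ s)) [^] (l::nat) \<and> j = p ^ s * l"
proof -
  define r where "r = j mod p ^ s"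
  have j: "j = p ^ s * (j div p ^ s) + r" by (simp add: r_def)
  have "m f ^ j = m f ^ r"
    by (subst j) (simp add: power_add power_mult m_f_power)
  moreover have "m f ^ j = 1" using assms by (simp add: K_def m_pow)
  moreover have "r < p ^ s" using q_pos by (simp add: r_def)
  ultimately have "r = 0" using m_order by (auto simp: root_of_unity_of_order_def)
  then show ?thesis using j by (metis add_0_right nat_pow_pow f_carrier)
qed

lemma m_fs: "h \<in> set fs \<Longrightarrow> m h = m f"
proof -
  assume h: "h \<in> set fs"
  then obtain g where g: "g \<in> H" "h \<otimes> g = g \<otimes> f"
    using conj_fs f_in_fs unfolding H_def by blast
  have "m h * m g = m g * m f"
    using g h in_H H_closed m_mult by (metis f_carrier)
  then show ?thesis using m_nonzero H_closed[OF g(1)] by simp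
qed

lemma fs_carrier: "h \<in> set fs \<Longrightarrow> h \<in> carrier G"
  using fs_closed by blast

lemma slope_K: "h \<in> set fs \<Longrightarrow> h \<otimes> inv f \<in> K"
  by (auto simp: K_def in_H fs_carrier m_mult m_inv m_fs m_nonzero intro!: H_rules)

text \<open>Moving \<open>f [^] j\<close> to the right past \<open>y\<close> conjugates
  \<open>y\<close> by it, and each conjugation by \<open>f\<close> multiplies \<alpha> by
  \<mu>.\<close>

lemma mult_normal_form:
  assumes "x \<in> K" "y \<in> K"
  shows "\<exists>z\<in>K. x \<otimes> f [^] (j::nat) \<otimes> (y \<otimes> f [^] (l::nat)) = z \<otimes> f [^] (j + l) \<and> \<alpha> z = \<alpha> x + \<mu> ^ j * \<alpha> y"
proof
  let ?z = "x \<otimes> (f [^] j \<otimes> y \<otimes> inv (f [^] j))"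
  have c: "x \<in> carrier G" "y \<in> carrier G" using assms K_closed by auto
  have k: "f [^] j \<otimes> y \<otimes> inv (f [^] j) \<in> K" using K_conj assms(2) by simp
  show "?z \<in> K" by (rule K_rules(1)[OF assms(1) k])
  have "?z \<otimes> f [^] (j + l) = x \<otimes> (f [^] j \<otimes> (y \<otimes> (inv (f [^] j) \<otimes> (f [^] j \<otimes> f [^] l))))"
    using c by (simp add: m_assoc nat_pow_mult[symmetric])
  then have "x \<otimes> f [^] j \<otimes> (y \<otimes> f [^] l) = ?z \<otimes> f [^] (j + l)"
    using c by (simp add: m_assoc inv_mult_cancel)
  moreover have "\<alpha> ?z = \<alpha> x + \<mu> ^ j * \<alpha> y"
    using \<alpha>_K_mult[OF assms(1) k] \<alpha>_pow_conj[OF assms(2)] by simp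
  ultimately show "x \<otimes> f [^] j \<otimes> (y \<otimes> f [^] l) = ?z \<otimes> f [^] (j + l) \<and> \<alpha> ?z = \<alpha> x + \<mu> ^ j * \<alpha> y"
    by blast
qed

lemma generator_normal_form: "h \<in> set fs \<Longrightarrow> h = h \<otimes> inv f \<otimes> f [^] (1::nat)"
  using fs_carrier by (simp add: m_assoc)

text \<open>This turns the relation among the generators into one about a power of \<open>f\<close>:
  with zero slopes, each factor contributes one \<open>f\<close> and a part in \<open>K\<close> on
  which \<alpha> vanishes.\<close>

lemma prod_normal_form:
  assumes "set hs \<subseteq> set fs" "slopes \<subseteq> {0}"
  shows "\<exists>x\<in>K. \<alpha> x = 0 \<and> foldr (\<otimes>) hs \<one> = x \<otimes> f [^] length hs"
  using assms(1)
proof (induction hs)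
  case Nil
  show ?case by (rule bexI[of _ \<one>]) (simp_all add: \<alpha>_one K_rules)
next
  case (Cons h hs)
  then obtain x where x: "x \<in> K" "\<alpha> x = 0" "foldr (\<otimes>) hs \<one> = x \<otimes> f [^] length hs"
    by auto
  have h: "h \<in> set fs" using Cons.prems by simp
  have "\<alpha> (h \<otimes> inv f) = 0" using assms(2) h by (auto simp: slopes_def)
  then show ?case
    using mult_normal_form[OF slope_K[OF h] x(1), of 1 "length hs"] generator_normal_form[OF h] x
    by (auto simp del: nat_pow_Suc)
qed

text \<open>The power of \<open>f\<close> in the conjugating element commutes with \<open>f\<close>
  and cancels, so \<open>x\<close> alone conjugates \<open>f\<close> to \<open>h\<close>. Then
  \<open>h \<otimes> inv f\<close> is the commutator of \<open>x\<close> and \<open>f\<close>, whose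
  factors \<open>x\<close> and \<open>f \<otimes> inv x \<otimes> inv f\<close> contribute
  \<open>\<alpha> x\<close> and \<open>- \<mu> * \<alpha> x\<close>.\<close>

lemma slope_conj:
  assumes "h \<in> set fs" "x \<in> K" "h \<otimes> (x \<otimes> f [^] (j::nat)) = x \<otimes> f [^] j \<otimes> f"
  shows "\<alpha> (h \<otimes> inv f) = (1 - \<mu>) * \<alpha> x"
proof -
  have c: "x \<in> carrier G" "h \<in> carrier G" using assms K_closed fs_carrier by auto
  have "f [^] j \<otimes> f = f \<otimes> f [^] j" using nat_pow_Suc2[of f j] by simp
  then have "h \<otimes> x \<otimes> f [^] j = x \<otimes> f \<otimes> f [^] j"
    using assms(3) c by (simp add: m_assoc)
  then have "h \<otimes> x = x \<otimes> f" using c by simp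
  then have "h = x \<otimes> f \<otimes> inv x" using c by (metis f_carrier inv_solve_right m_closed)
  then have "h \<otimes> inv f = x \<otimes> (f \<otimes> inv x \<otimes> inv f)" using c by (simp add: m_assoc)
  moreover have "inv x \<in> K" using assms(2) by (rule K_rules)
  ultimately show ?thesis
    using assms(2) by (simp add: \<alpha>_K_mult K_conj \<alpha>_f_conj \<alpha>_inv algebra_simps)
qed

text \<open>Only exponents in the natural numbers are allowed, so \<open>inv f\<close> is rewritten
  as \<open>inv (f [^] (p ^ s))\<close> times \<open>f [^] (p ^ s - 1)\<close>. The first factor
  lies in \<open>K\<close>, which is why its value under \<alpha> enters \<open>A\<close>.\<close>

lemma normal_form:
  assumes "g \<in> H"
  defines "A \<equiv> insert (\<alpha> (f [^] (p ^ s))) slopes"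
  shows "\<exists>x\<in>K. \<exists>j::nat. \<alpha> x \<in> cyc_span \<mu> A \<and> g = x \<otimes> f [^] j"
  using assms(1) unfolding H_def
proof (induction rule: generate.induct)
  case one
  show ?case
    by (intro bexI[of _ \<one>] exI[of _ 0]) (simp_all add: \<alpha>_one cyc_span.zero K_rules)
next
  case (incl h)
  then show ?case
    using generator_normal_form slope_K by (intro bexI[of _ "h \<otimes> inv f"] exI[of _ 1])
      (auto simp: A_def slopes_def intro: cyc_span.base)
next
  case (inv h)
  let ?q = "p ^ s"
  let ?y = "inv h \<otimes> f" and ?x = "inv h \<otimes> f \<otimes> inv (f [^] ?q)"
  have h: "h \<in> carrier G" using inv fs_carrier by simp
  have y: "?y \<in> K"
    using inv by (auto simp: K_def in_H fs_carrier m_mult m_inv m_fs m_nonzero intro!: H_rules)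
  \<comment> \<open>Conjugating \<open>?y\<close> by \<open>f\<close> gives the inverse of
    \<open>h \<otimes> inv f\<close>, so \<open>\<mu> * \<alpha> ?y\<close> is a negated slope; the
    factor \<mu> is then removed by multiplying with \<open>\<mu> ^ (?q - 1)\<close>.\<close>
  have "\<mu> * \<alpha> ?y = \<alpha> (f \<otimes> ?y \<otimes> inv f)" using \<alpha>_f_conj[OF y] by simp
  also have "f \<otimes> ?y \<otimes> inv f = inv (h \<otimes> inv f)" using h by (simp add: m_assoc inv_mult_group inv_mult_cancel mult_inv_cancel)
  finally have "\<mu> * \<alpha> ?y = - \<alpha> (h \<otimes> inv f)" using \<alpha>_inv slope_K inv by simp
  then have "- (\<mu> * \<alpha> ?y) \<in> cyc_span \<mu> A"
    using inv by (auto simp: A_def slopes_def intro: cyc_span.base)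
  then have "\<mu> ^ (?q - 1) * (\<mu> * \<alpha> ?y) \<in> cyc_span \<mu> A"
    using cyc_span_uminus cyc_span_power by (metis minus_minus)
  moreover have "\<mu> ^ (?q - 1) * (\<mu> * \<alpha> ?y) = \<alpha> ?y"
    using \<mu>_power q_pos by (metis mult.assoc mult_1 power_minus_mult)
  ultimately have \<alpha>y: "\<alpha> ?y \<in> cyc_span \<mu> A" by (simp only:)
  have "\<alpha> (f [^] ?q) \<in> cyc_span \<mu> A" by (simp add: A_def cyc_span.base)
  with \<alpha>y have "\<alpha> ?x \<in> cyc_span \<mu> A"
    using \<alpha>_K_mult[OF y K_rules(2)[OF fq_K]] \<alpha>_inv[OF fq_K] cyc_span.diff by fastforce
  moreover have "?x \<in> K" by (rule K_rules(1)[OF y K_rules(2)[OF fq_K]])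
  moreover have "inv h = ?x \<otimes> f [^] (?q - 1)"
  proof -
    have "f [^] ?q = f [^] (?q - 1) \<otimes> f" using q_pos nat_pow_Suc[of f "?q - 1"] by (metis Suc_pred')
    then have "?x \<otimes> f [^] (?q - 1) = inv h \<otimes> (f \<otimes> (inv f \<otimes> (inv (f [^] (?q - 1)) \<otimes> f [^] (?q - 1))))"
      using h by (simp only: m_assoc inv_mult_group inv_closed f_carrier nat_pow_closed m_closed)
    then show ?thesis using h by simp
  qed
  ultimately show ?case by blast
next
  case (eng g h)
  then obtain x y and j l :: nat where "x \<in> K" "\<alpha> x \<in> cyc_span \<mu> A" "g = x \<otimes> f [^] j"
      "y \<in> K" "\<alpha> y \<in> cyc_span \<mu> A" "h = y \<otimes> f [^] l"
    by blast
  then show ?case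
    using mult_normal_form[of x y j l] cyc_span_add cyc_span_power by metis
qed

section \<open>Vanishing of \<alpha> on \<open>K\<close>\<close>

lemma slope_eq:
  assumes "h \<in> set fs"
  shows "\<exists>x\<in>K. \<alpha> (h \<otimes> inv f) = (1 - \<mu>) * \<alpha> x"
proof -
  obtain g where g: "g \<in> H" "h \<otimes> g = g \<otimes> f"
    using conj_fs[OF assms f_in_fs] unfolding H_def by blast
  then show ?thesis using normal_form[OF g(1)] slope_conj[OF assms] by metis
qed

lemma \<alpha>_fq: "\<alpha> (f [^] (p ^ s)) = 0"
proof (cases "\<mu> = 1")
  case False
  \<comment> \<open>Since \<open>f\<close> commutes with its power, the value
    \<open>\<alpha> (f [^] (p ^ s))\<close> is fixed by multiplication with
    \<open>\<mu> \<noteq> 1\<close>.\<close>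
  have "f \<otimes> f [^] (p ^ s) \<otimes> inv f = f [^] (p ^ s)"
    using nat_pow_Suc2[of f "p ^ s"] by (simp flip: nat_pow_Suc2 add: m_assoc[of "f [^] (p ^ s)" f "inv f"])
  then show ?thesis using \<alpha>_f_conj[OF fq_K] False by auto
next
  case True
  \<comment> \<open>Now \<open>1 - \<mu> = 0\<close>, so every slope vanishes and the relation among
    the generators puts \<open>f [^] length fs\<close> into the kernel of \<alpha>.\<close>
  then have "slopes \<subseteq> {0}" using slope_eq by (auto simp: slopes_def)
  then obtain x where x: "x \<in> K" "\<alpha> x = 0" "\<one> = x \<otimes> f [^] length fs"
    using prod_normal_form[of fs] prod_fs by auto
  have "f [^] length fs = inv x"
    using x K_closed by (metis f_carrier inv_equality inv_inv nat_pow_closed)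
  then have fK: "f [^] length fs \<in> K" and f0: "\<alpha> (f [^] length fs) = 0"
    using x K_rules \<alpha>_inv by simp_all
  obtain l where l: "f [^] length fs = (f [^] (p ^ s)) [^] (l::nat)" "length fs = p ^ s * l"
    using pow_K[OF fK] by blast
  \<comment> \<open>The list contains \<open>f\<close>, so its length is positive; a nonzero
    multiple \<open>l\<close> can then be cancelled in the complex numbers.\<close>
  have "l \<noteq> 0" using l(2) f_in_fs by (metis length_pos_if_in_set less_numeral_extra(3) mult_0_right)
  then show ?thesis using \<alpha>_K_pow[OF fq_K, of l] f0 l(1) by simp
qed

text \<open>If an element of \<open>K\<close> is in normal form, its power of \<open>f\<close> also
  lies in \<open>K\<close>, hence is a power of \<open>f [^] (p ^ s)\<close> and contributes
  nothing. The inserted 0 is the value of \<alpha> at \<open>f [^] (p ^ s)\<close>.\<close>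

lemma \<alpha>_in_cyc_span:
  assumes "x \<in> K"
  shows "\<alpha> x \<in> cyc_span \<mu> (insert 0 slopes)"
proof -
  obtain y and j :: nat where y: "y \<in> K" "\<alpha> y \<in> cyc_span \<mu> (insert 0 slopes)" "x = y \<otimes> f [^] j"
    using normal_form[OF K_H[OF assms]] \<alpha>_fq by auto
  have "f [^] j = inv y \<otimes> x" using y K_closed[OF y(1)] by (simp add: inv_mult_cancel)
  then have j: "f [^] j \<in> K" using y(1) assms K_rules by simp
  then obtain l where "f [^] j = (f [^] (p ^ s)) [^] (l::nat)" using pow_K by blast
  then have "\<alpha> (f [^] j) = 0" using \<alpha>_K_pow[OF fq_K] \<alpha>_fq by simp
  then show ?thesis using y j \<alpha>_K_mult by simp
qed

lemma \<alpha>_trivial: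
  assumes "x \<in> K"
  shows "\<alpha> x = 0"
proof -
  have "cyc_span \<mu> (insert 0 slopes) \<subseteq> {0}"
  proof (rule cyc_span_nakayama[OF _ prime_p \<mu>_power])
    show "finite (insert 0 slopes)" by (simp add: slopes_def)
    fix a assume "a \<in> insert 0 slopes"
    then show "\<exists>x\<in>cyc_span \<mu> (insert 0 slopes). a = (1 - \<mu>) * x"
      using slope_eq \<alpha>_in_cyc_span cyc_span.zero by (fastforce simp: slopes_def)
  qed
  then show ?thesis using \<alpha>_in_cyc_span[OF assms] by auto
qed

end

section \<open>Leading coefficients of germs\<close>

lemma local_diffeo0_holomorphic:
  assumes "local_diffeo0 f"
  obtains r where "0 < r" "f holomorphic_on ball 0 r" "inj_on f (ball 0 r)" "f 0 = 0"
proof -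
  obtain U V g where f: "f 0 = 0" "open U" "0 \<in> U" "f holomorphic_on U" "homeomorphism U V f g"
    using assms unfolding local_diffeo0_def by blast
  then obtain r where r: "0 < r" "ball 0 r \<subseteq> U" using open_contains_ball by blast
  have "inj_on f U" using f(5) by (metis homeomorphism_apply1 inj_onI)
  then show ?thesis using that r f holomorphic_on_subset inj_on_subset by metis
qed

text \<open>Injectivity near 0 keeps nonzero points away from 0, so a germ may be substituted into
  limits over punctured neighbourhoods.\<close>

lemma local_diffeo0_at:
  assumes "local_diffeo0 f"
  shows "filterlim f (at 0) (at 0)"
proof -
  obtain r where r: "0 < r" "inj_on f (ball 0 r)" "f 0 = 0"
    using local_diffeo0_holomorphic[OF assms] by blast
  have "filterlim f (nhds 0) (at 0)"
    using local_diffeo0_filterlim[OF assms] by (rule filterlim_mono) (auto simp: at_within_def)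
  moreover have "eventually (\<lambda>z. f z \<noteq> 0) (at 0)"
    unfolding eventually_at
  proof (intro exI[of _ r] conjI ballI impI)
    fix z :: complex assume "z \<noteq> 0 \<and> dist z 0 < r"
    then show "f z \<noteq> 0" using r inj_onD[OF r(2), of z 0] by auto
  qed (use r in auto)
  ultimately show ?thesis by (simp add: filterlim_at)
qed

lemma local_diffeo0_has_field_derivative:
  assumes "local_diffeo0 f"
  shows "(f has_field_derivative deriv f 0) (at 0)"
proof -
  obtain r where "0 < r" "f holomorphic_on ball 0 r"
    using local_diffeo0_holomorphic[OF assms] by blast
  then show ?thesis by (intro holomorphic_derivI[of f "ball 0 r"]) auto
qed

lemma local_diffeo0_quotient:
  assumes "local_diffeo0 f"
  shows "((\<lambda>z. f z / z) \<longlongrightarrow> deriv f 0) (at 0)"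
proof -
  have "f 0 = 0" using assms by (simp add: local_diffeo0_def)
  then show ?thesis
    using local_diffeo0_has_field_derivative[OF assms] by (simp add: has_field_derivative_iff)
qed

text \<open>This encodes the expansion z + a z^(k+1) + o(z^(k+1)) at 0; \<open>a = 0\<close> is
  allowed.\<close>

definition tangent_coeff :: "nat \<Rightarrow> (complex \<Rightarrow> complex) \<Rightarrow> complex \<Rightarrow> bool" where
  "tangent_coeff k f a \<longleftrightarrow> ((\<lambda>z. (f z - z) / z ^ Suc k) \<longlongrightarrow> a) (at 0)"

text \<open>Substitute \<open>g z\<close> into the limit that defines the coefficient and multiply
  by \<open>(g z / z) ^ Suc k\<close>, which tends to a power of the derivative.\<close>

lemma tangent_coeff_after:
  assumes "local_diffeo0 g" "tangent_coeff k f a"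
  shows "((\<lambda>z. (f (g z) - g z) / z ^ Suc k) \<longlongrightarrow> a * deriv g 0 ^ Suc k) (at 0)"
proof -
  have "((\<lambda>z. (f (g z) - g z) / g z ^ Suc k * (g z / z) ^ Suc k) \<longlongrightarrow> a * deriv g 0 ^ Suc k) (at 0)"
    using filterlim_compose[OF assms(2)[unfolded tangent_coeff_def] local_diffeo0_at[OF assms(1)]]
    by (intro tendsto_mult tendsto_power local_diffeo0_quotient assms(1))
  moreover have "eventually (\<lambda>z. g z \<noteq> 0) (at 0)"
    using local_diffeo0_at[OF assms(1)] by (simp add: filterlim_at)
  then have "eventually (\<lambda>z. (f (g z) - g z) / g z ^ Suc k * (g z / z) ^ Suc k = (f (g z) - g z) / z ^ Suc k) (at 0)"
    by eventually_elim (simp add: power_divide)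
  ultimately show ?thesis by (rule Lim_transform_eventually)
qed

lemma tangent_coeff_comp:
  assumes "local_diffeo0 g" "deriv g 0 = 1" "tangent_coeff k f a" "tangent_coeff k g b"
  shows "tangent_coeff k (f \<circ> g) (a + b)"
proof -
  have "((\<lambda>z. (f (g z) - g z) / z ^ Suc k + (g z - z) / z ^ Suc k) \<longlongrightarrow> a + b) (at 0)"
    using tendsto_add[OF tangent_coeff_after[OF assms(1,3)] assms(4)[unfolded tangent_coeff_def]] assms(2)
    by simp
  then show ?thesis
    unfolding tangent_coeff_def by (simp add: add_divide_distrib[symmetric])
qed

text \<open>A holomorphic map is strictly differentiable: \<open>f\<close> minus its linear part has
  small derivative near 0, hence a small Lipschitz constant on a ball.\<close>

lemma strict_derivative_quotient:
  assumes "local_diffeo0 f" "filterlim g (nhds 0) (at 0)"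
  shows "((\<lambda>z. (f (g z) - f z - deriv f 0 * (g z - z)) / (g z - z)) \<longlongrightarrow> 0) (at 0)"
proof (rule tendstoI)
  fix e :: real assume e: "0 < e"
  obtain r where r: "0 < r" "f holomorphic_on ball 0 r"
    using local_diffeo0_holomorphic[OF assms(1)] by blast
  have "isCont (deriv f) 0"
    using holomorphic_deriv[OF r(2)] r(1)
    by (metis centre_in_ball continuous_on_interior holomorphic_on_imp_continuous_on interior_ball open_ball)
  then obtain d where d: "0 < d" "\<And>z. dist z 0 < d \<Longrightarrow> dist (deriv f z) (deriv f 0) < e / 2"
    using e unfolding continuous_at_eps_delta by (metis half_gt_zero)
  define B where "B = ball (0::complex) (min r d)"
  have bound: "norm ((f u - deriv f 0 * u) - (f v - deriv f 0 * v)) \<le> e / 2 * norm (u - v)"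
    if "u \<in> B" "v \<in> B" for u v
  proof (rule field_differentiable_bound[of B _ "\<lambda>z. deriv f z - deriv f 0"])
    show "convex B" by (simp add: B_def)
    fix z assume z: "z \<in> B"
    then have "(f has_field_derivative deriv f z) (at z)"
      by (intro holomorphic_derivI[OF r(2)]) (auto simp: B_def)
    then show "((\<lambda>z. f z - deriv f 0 * z) has_field_derivative deriv f z - deriv f 0) (at z within B)"
      using DERIV_diff[OF has_field_derivative_at_within DERIV_cmult[OF DERIV_ident]] by fastforce
    show "norm (deriv f z - deriv f 0) \<le> e / 2"
      using d(2)[of z] z by (simp add: B_def dist_norm)
  qed (use that in auto)
  have B: "eventually (\<lambda>z. z \<in> B) (nhds 0)"
    using r(1) d(1) by (intro eventually_nhds_in_open) (auto simp: B_def)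
  then have "eventually (\<lambda>z. g z \<in> B) (at 0)"
    using assms(2) by (rule eventually_compose_filterlim)
  moreover have "eventually (\<lambda>z. z \<in> B) (at 0)"
    using B by (simp add: eventually_at_filter eventually_mono)
  ultimately show "eventually (\<lambda>z. dist ((f (g z) - f z - deriv f 0 * (g z - z)) / (g z - z)) 0 < e) (at 0)"
  proof eventually_elim
    case (elim z)
    show ?case
    \<comment> \<open>At fixed points of \<open>g\<close> the quotient is 0 by the convention for
      division by zero.\<close>
    proof (cases "g z = z")
      case False
      have "norm (f (g z) - f z - deriv f 0 * (g z - z)) \<le> e / 2 * norm (g z - z)"
        using bound[OF elim] by (simp add: algebra_simps)
      then have "norm ((f (g z) - f z - deriv f 0 * (g z - z)) / (g z - z)) \<le> e / 2"
        using False by (simp add: norm_divide divide_le_eq)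
      then show ?thesis using e by simp
    qed (use e in simp)
  qed
qed

text \<open>Both sides of the relation are compared with \<open>f z\<close> at order
  \<open>Suc k\<close>: the left differs from it by \<open>deriv f 0\<close> times the displacement
  of \<open>g\<close>, up to a smaller error, and the right by the displacement of \<open>g'\<close>
  at \<open>f z\<close>.\<close>

lemma tangent_coeff_conj:
  assumes "local_diffeo0 f" "local_diffeo0 g"
    and "eventually (\<lambda>z. f (g z) = g' (f z)) (nhds 0)"
    and "tangent_coeff k g a" "tangent_coeff k g' a'"
  shows "deriv f 0 * a = a' * deriv f 0 ^ Suc k"
proof -
  let ?D = "\<lambda>z. f (g z) - f z - deriv f 0 * (g z - z)"
  have g: "((\<lambda>z. (g z - z) / z ^ Suc k) \<longlongrightarrow> a) (at 0)"
    using assms(4) by (simp add: tangent_coeff_def)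
  have "filterlim g (nhds 0) (at 0)"
    using local_diffeo0_at[OF assms(2)] by (simp add: filterlim_at)
  from tendsto_add[OF tendsto_mult[OF strict_derivative_quotient[OF assms(1) this] g]
      tendsto_mult[OF tendsto_const[of "deriv f 0"] g]]
  have "((\<lambda>z. ?D z / (g z - z) * ((g z - z) / z ^ Suc k) + deriv f 0 * ((g z - z) / z ^ Suc k))
      \<longlongrightarrow> deriv f 0 * a) (at 0)" by simp
  moreover have "?D z / (g z - z) * ((g z - z) / z ^ Suc k) + deriv f 0 * ((g z - z) / z ^ Suc k)
      = (f (g z) - f z) / z ^ Suc k" for z
    by (cases "g z = z") (simp_all add: add_divide_distrib[symmetric] del: power_Suc)
  ultimately have "((\<lambda>z. (f (g z) - f z) / z ^ Suc k) \<longlongrightarrow> deriv f 0 * a) (at 0)" by (simp del: power_Suc)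
  moreover have "eventually (\<lambda>z. f (g z) = g' (f z)) (at 0)"
    using assms(3) by (simp add: eventually_at_filter eventually_mono)
  then have "eventually (\<lambda>z. (f (g z) - f z) / z ^ Suc k = (g' (f z) - f z) / z ^ Suc k) (at 0)"
    by eventually_elim simp
  ultimately have "((\<lambda>z. (g' (f z) - f z) / z ^ Suc k) \<longlongrightarrow> deriv f 0 * a) (at 0)"
    by (rule Lim_transform_eventually)
  then show ?thesis
    using tangent_coeff_after[OF assms(1,5)] tendsto_unique[OF trivial_limit_at] by blast
qed

text \<open>The nonconstant holomorphic function \<open>f z - z\<close> has a zero of some finite
  order \<open>n > 0\<close> at 0; then \<open>k = n - 1\<close>.\<close>

lemma tangent_coeff_exists:
  assumes "local_diffeo0 f" "\<not> eventually (\<lambda>z. f z = z) (nhds 0)"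
  shows "\<exists>k a. a \<noteq> 0 \<and> tangent_coeff k f a"
proof -
  obtain r where r: "0 < r" "f holomorphic_on ball 0 r" "f 0 = 0"
    using local_diffeo0_holomorphic[OF assms(1)] by blast
  have "\<not> (\<lambda>z. f z - z) constant_on ball 0 r"
  proof
    assume "(\<lambda>z. f z - z) constant_on ball 0 r"
    then obtain c where c: "\<And>z. z \<in> ball 0 r \<Longrightarrow> f z - z = c" unfolding constant_on_def by blast
    have "\<And>z. z \<in> ball 0 r \<Longrightarrow> f z = z" using c c[of 0] r by auto
    then have "eventually (\<lambda>z. f z = z) (nhds 0)"
      using eventually_nhds_in_open[of "ball 0 r" 0] r(1) by (auto elim: eventually_mono)
    then show False using assms(2) by blast
  qed
  moreover have "(\<lambda>z. f z - z) holomorphic_on ball 0 r" using r(2) by (intro holomorphic_intros)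
  ultimately obtain h \<rho> n where h: "0 < n" "0 < \<rho>" "h holomorphic_on ball 0 \<rho>"
      "\<And>w. w \<in> ball 0 \<rho> \<Longrightarrow> f w - w = (w - 0) ^ n * h w" "\<And>w. w \<in> ball 0 \<rho> \<Longrightarrow> h w \<noteq> 0"
    using r by (elim holomorphic_factor_zero_nonconstant[of "\<lambda>z. f z - z" "ball 0 r" 0]) auto
  have "isCont h 0"
    using h(2,3) by (metis centre_in_ball continuous_on_interior holomorphic_on_imp_continuous_on interior_ball)
  then have "(h \<longlongrightarrow> h 0) (at 0)" by (simp add: isCont_def)
  moreover have "eventually (\<lambda>z. h z = (f z - z) / z ^ n) (at 0)"
    unfolding eventually_at using h(2,4) by (intro exI[of _ \<rho>]) (auto simp: dist_commute)
  ultimately have "((\<lambda>z. (f z - z) / z ^ n) \<longlongrightarrow> h 0) (at 0)" by (rule Lim_transform_eventually)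
  then have "tangent_coeff (n - 1) f (h 0)" using h(1) by (simp add: tangent_coeff_def)
  then show ?thesis using h(2,5) by (intro exI[of _ "n - 1"] exI[of _ "h 0"]) simp
qed

lemma tangent_coeff_lower:
  assumes "tangent_coeff k f a" "j < k"
  shows "tangent_coeff j f 0"
proof -
  have "((\<lambda>z. (f z - z) / z ^ Suc k * z ^ (k - j)) \<longlongrightarrow> a * 0 ^ (k - j)) (at 0)"
    using assms(1) unfolding tangent_coeff_def by (intro tendsto_intros)
  moreover have "eventually (\<lambda>z. (f z - z) / z ^ Suc k * z ^ (k - j) = (f z - z) / z ^ Suc j) (at (0::complex))"
    unfolding eventually_at
  proof (intro exI[of _ 1] conjI ballI impI)
    fix z :: complex assume "z \<noteq> 0 \<and> dist z 0 < 1"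
    moreover have "z ^ Suc k = z ^ (k - j) * z ^ Suc j"
      using assms(2) by (simp flip: power_add)
    ultimately show "(f z - z) / z ^ Suc k * z ^ (k - j) = (f z - z) / z ^ Suc j"
      by (simp del: power_Suc)
  qed simp
  ultimately have "((\<lambda>z. (f z - z) / z ^ Suc j) \<longlongrightarrow> a * 0 ^ (k - j)) (at 0)"
    by (rule Lim_transform_eventually)
  then show ?thesis using assms(2) by (simp add: tangent_coeff_def power_0_left)
qed

text \<open>This is a relation because for a given \<open>k\<close> the limit need not
  exist.\<close>

lift_definition germ_coeff :: "nat \<Rightarrow> diff_germ \<Rightarrow> complex \<Rightarrow> bool" is tangent_coeff
proof (rule ext)
  fix k f f' a assume "germ_eq f f'"
  then have "eventually (\<lambda>z. f z = f' z) (at 0)"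
    unfolding germ_eq_def by (auto simp: eventually_at_filter elim: eventually_mono)
  then have "eventually (\<lambda>z. (f z - z) / z ^ Suc k = (f' z - z) / z ^ Suc k) (at 0)"
    by eventually_elim simp
  then show "tangent_coeff k f a = tangent_coeff k f' a"
    unfolding tangent_coeff_def by (rule tendsto_cong)
qed

lemma multiplier_comp: "multiplier (germ_comp F G) = multiplier F * multiplier G"
proof transfer
  fix f g assume "germ_eq f f" "germ_eq g g"
  then have f: "local_diffeo0 f" and g: "local_diffeo0 g" by (simp_all add: germ_eq_def)
  have "(f has_field_derivative deriv f 0) (at (g 0))"
    using local_diffeo0_has_field_derivative[OF f] g by (simp add: local_diffeo0_def)
  from DERIV_chain[OF this local_diffeo0_has_field_derivative[OF g]]
  show "deriv (f \<circ> g) 0 = deriv f 0 * deriv g 0" by (rule DERIV_imp_deriv)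
qed

lemma multiplier_id: "multiplier germ_id = 1"
  by transfer simp

lemma multiplier_nonzero: "multiplier F \<noteq> 0"
  using germ_inverse_exists[of F] multiplier_comp multiplier_id by (metis mult_zero_right zero_neq_one)

lemma germ_coeff_id: "germ_coeff k germ_id 0"
  by transfer (simp add: tangent_coeff_def)

lemma germ_coeff_unique: "germ_coeff k F a \<Longrightarrow> germ_coeff k F b \<Longrightarrow> a = b"
  by transfer (auto simp: tangent_coeff_def intro: tendsto_unique[OF trivial_limit_at])

lemma germ_coeff_comp:
  "multiplier G = 1 \<Longrightarrow> germ_coeff k F a \<Longrightarrow> germ_coeff k G b \<Longrightarrow> germ_coeff k (germ_comp F G) (a + b)"
  by transfer (auto simp: germ_eq_def intro: tangent_coeff_comp)

lemma germ_coeff_conj: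
  "germ_comp F G = germ_comp G' F \<Longrightarrow> germ_coeff k G a \<Longrightarrow> germ_coeff k G' a' \<Longrightarrow>
   multiplier F * a = a' * multiplier F ^ Suc k"
  by transfer (auto simp: germ_eq_def simp del: power_Suc intro: tangent_coeff_conj)

lemma germ_coeff_exists: "F \<noteq> germ_id \<Longrightarrow> \<exists>k a. a \<noteq> 0 \<and> germ_coeff k F a"
  by transfer (auto simp: germ_eq_def local_diffeo0_id intro: tangent_coeff_exists)

lemma germ_coeff_lower: "germ_coeff k F a \<Longrightarrow> j < k \<Longrightarrow> germ_coeff j F 0"
  by transfer (auto intro: tangent_coeff_lower)

section \<open>Finiteness\<close>

theorem theoremA:
  fixes G :: "diff_germ set" and fs :: "diff_germ list" and p s :: nat
  assumes "irreducible_germ_group G"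
    and "basic_generators G fs"
    and "prime p"
    and "\<exists>f\<in>set fs. root_of_unity_of_order (p ^ s) (multiplier f)"
  shows "finite G"
proof -
  interpret D: group Diff0 by (rule group_Diff0)
  have carrier: "carrier Diff0 = UNIV" and mult: "mult Diff0 = germ_comp" and one: "\<one>\<^bsub>Diff0\<^esub> = germ_id"
    by (simp_all add: Diff0_def)
  let ?q = "p ^ s"
  obtain f where f: "f \<in> set fs" "root_of_unity_of_order ?q (multiplier f)" using assms(4) by blast
  have gen: "generate Diff0 (set fs) = G" and prod: "foldr (mult Diff0) fs \<one>\<^bsub>Diff0\<^esub> = \<one>\<^bsub>Diff0\<^esub>"
    and conj: "\<And>h h'. h \<in> set fs \<Longrightarrow> h' \<in> set fs \<Longrightarrow> \<exists>g\<in>G. h \<otimes>\<^bsub>Diff0\<^esub> g = g \<otimes>\<^bsub>Diff0\<^esub> h'"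
    using assms(2) unfolding basic_generators_def by blast+
  have sub: "subgroup G Diff0" using assms(1) by (simp add: irreducible_germ_group_def)
  have q: "0 < ?q" "multiplier f ^ ?q = 1" using f(2) by (simp_all add: root_of_unity_of_order_def)
  have fG: "f \<in> G" using f(1) generate.incl gen by metis
  have mul: "multiplier (x \<otimes>\<^bsub>Diff0\<^esub> y) = multiplier x * multiplier y" for x y
    by (simp add: mult multiplier_comp)
  have mul_inv: "multiplier (inv\<^bsub>Diff0\<^esub> x) = inverse (multiplier x)" for x
    using mul[of x "inv\<^bsub>Diff0\<^esub> x"] multiplier_nonzero[of x]
    by (simp add: carrier one multiplier_id field_simps)
  \<comment> \<open>Triviality of the kernel makes the multiplier an embedding of \<open>G\<close>
    into a finite group of roots of unity.\<close>
  have triv: "g = germ_id" if "g \<in> G" "multiplier g = 1" for g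
  proof (rule ccontr)
    assume "g \<noteq> germ_id"
    define P where "P k \<longleftrightarrow> (\<exists>g a. g \<in> G \<and> multiplier g = 1 \<and> a \<noteq> 0 \<and> germ_coeff k g a)" for k
    define k where "k = (LEAST k. P k)"
    have "\<exists>k. P k" unfolding P_def using germ_coeff_exists[OF \<open>g \<noteq> germ_id\<close>] that by blast
    then have "P k" unfolding k_def by (rule LeastI_ex)
    then obtain x a where x: "x \<in> G" "multiplier x = 1" "a \<noteq> 0" "germ_coeff k x a"
      unfolding P_def by blast
    \<comment> \<open>Minimality of \<open>k\<close> gives every element of the kernel a coefficient
      at level \<open>k\<close>: its leading level is at least \<open>k\<close>, and below that
      level the coefficient is 0.\<close>
    have ex: "\<exists>a. germ_coeff k y a" if y: "y \<in> G" "multiplier y = 1" for y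
    proof (cases "y = germ_id")
      case True
      then show ?thesis using germ_coeff_id by blast
    next
      case False
      then obtain j b where j: "b \<noteq> 0" "germ_coeff j y b" using germ_coeff_exists by blast
      then have "P j" unfolding P_def using y by blast
      then have "k \<le> j" unfolding k_def by (rule Least_le)
      then show ?thesis using j(2) germ_coeff_lower by (metis le_neq_implies_less)
    qed
    define \<alpha> where "\<alpha> y = (SOME a. germ_coeff k y a)" for y
    have \<alpha>: "germ_coeff k y (\<alpha> y)" if "y \<in> G" "multiplier y = 1" for y
      using someI_ex[OF ex[OF that]] by (simp add: \<alpha>_def)
    have \<alpha>_mult: "\<alpha> (y \<otimes>\<^bsub>Diff0\<^esub> z) = \<alpha> y + \<alpha> z"
      if "y \<in> G" "z \<in> G" "multiplier y = 1" "multiplier z = 1" for y z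
    proof -
      have "germ_coeff k (y \<otimes>\<^bsub>Diff0\<^esub> z) (\<alpha> y + \<alpha> z)"
        using \<alpha> that by (simp add: mult germ_coeff_comp)
      moreover have "germ_coeff k (y \<otimes>\<^bsub>Diff0\<^esub> z) (\<alpha> (y \<otimes>\<^bsub>Diff0\<^esub> z))"
        using that \<alpha> mul subgroup.m_closed[OF sub] by simp
      ultimately show ?thesis using germ_coeff_unique by blast
    qed
    have \<alpha>_conj: "\<alpha> (f \<otimes>\<^bsub>Diff0\<^esub> y \<otimes>\<^bsub>Diff0\<^esub> inv\<^bsub>Diff0\<^esub> f) = inverse (multiplier f ^ k) * \<alpha> y"
      if y: "y \<in> G" "multiplier y = 1" for y
    proof -
      let ?c = "f \<otimes>\<^bsub>Diff0\<^esub> y \<otimes>\<^bsub>Diff0\<^esub> inv\<^bsub>Diff0\<^esub> f"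
      have c: "?c \<in> G" using y(1) fG sub by (simp add: subgroup.m_closed subgroup.m_inv_closed)
      have "multiplier ?c = 1" using y(2) mul mul_inv multiplier_nonzero by simp
      \<comment> \<open>Comparing coefficients in this relation gives one factor of the multiplier
        on the left and \<open>Suc k\<close> on the right, whence the inverse \<open>k\<close>-th
        power.\<close>
      moreover have "f \<otimes>\<^bsub>Diff0\<^esub> y = ?c \<otimes>\<^bsub>Diff0\<^esub> f" by (simp add: D.m_assoc carrier)
      ultimately have "multiplier f * \<alpha> y = \<alpha> ?c * multiplier f ^ Suc k"
        using germ_coeff_conj[of f y ?c k "\<alpha> y" "\<alpha> ?c"] \<alpha> y c by (simp add: mult)
      then show ?thesis using multiplier_nonzero[of f] by (simp add: field_simps)
    qed
    have "(multiplier f ^ k) ^ ?q = 1"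
      using q(2) by (metis mult.commute power_mult power_one)
    then have \<mu>: "inverse (multiplier f ^ k) ^ ?q = 1" by (simp only: power_inverse inverse_1)
    interpret C: conjugate_generators Diff0 fs f multiplier \<alpha> "inverse (multiplier f ^ k)" p s
      by unfold_locales
        (use f prod conj mul multiplier_nonzero assms(3) \<alpha>_mult \<alpha>_conj \<mu> in \<open>simp_all add: carrier gen\<close>)
    have "\<alpha> x = 0" using C.\<alpha>_trivial[of x] x by (simp add: C.K_def C.H_def gen)
    then show False using germ_coeff_unique x \<alpha> by metis
  qed
  have "inj_on multiplier G"
  proof (rule inj_onI)
    fix x y assume xy: "x \<in> G" "y \<in> G" "multiplier x = multiplier y"
    have "x \<otimes>\<^bsub>Diff0\<^esub> inv\<^bsub>Diff0\<^esub> y \<in> G"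
      using xy sub by (simp add: subgroup.m_closed subgroup.m_inv_closed)
    then have "x \<otimes>\<^bsub>Diff0\<^esub> inv\<^bsub>Diff0\<^esub> y = \<one>\<^bsub>Diff0\<^esub>"
      using triv xy(3) mul mul_inv multiplier_nonzero one by simp
    then show "x = y" using D.inv_equality[of x "inv\<^bsub>Diff0\<^esub> y"] carrier by simp
  qed
  moreover have "multiplier ` G \<subseteq> {z. z ^ ?q = 1}"
  proof clarify
    have fs: "multiplier h ^ ?q = 1" if h: "h \<in> set fs" for h
    proof -
      obtain g where "h \<otimes>\<^bsub>Diff0\<^esub> g = g \<otimes>\<^bsub>Diff0\<^esub> f" using conj h f(1) by blast
      then have "multiplier h * multiplier g = multiplier g * multiplier f" using mul by metis
      then show ?thesis using multiplier_nonzero[of g] q(2) by simp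
    qed
    fix g assume "g \<in> G"
    then have "g \<in> generate Diff0 (set fs)" using gen by simp
    then show "multiplier g ^ ?q = 1"
      by induction (simp_all add: one multiplier_id mul mul_inv fs power_mult_distrib power_inverse)
  qed
  moreover have "finite {z::complex. z ^ ?q = 1}"
    by (rule finite_roots_unity) (use q(1) in linarith)
  ultimately show ?thesis by (rule inj_on_finite)
qed

end
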